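(* Let $k$ be a field and $n\ge3$. Let $\mathcal C(K_n)$ denote the set of circuits (in the sense of graphs, i.e. edge sets of simple cycles) of the complete graph $K_n$ on the vertex set $[n]=\{1,\dots,n\}$, each edge being regarded as a two-element subset of $[n]$. Then \[ \mathcal C^n_{n-2}[k]=\big\{\{[n]\setminus e:e\in C\}:C\in\mathcal C(K_n)\big\}. \]
   Context: Let $\binom{[n]}{p}$ be the set of $p$-element subsets of $[n]$. For $1\le p<n$ let $M(n,p)$ be the matrix over $k$ with rows indexed by $\binom{[n]}{p}$ and columns indexed by $\binom{[n]}{p+1}$, with $(\sigma,\tau)$ entry equal to $0$ if $\sigma\not\subset\tau$ and, if $\sigma\subset\tau$ with $\tau\setminus\sigma=\{j\}$, equal to $(-1)^{\#\{s\in\tau:\,s<j\}}$. $\mathcal C^n_p[k]$ is the collection of all $C\subset\binom{[n]}{p}$ such that the rows of $M(n,p)$ indexed by $C$ form a minimal linearly dependent set over $k$. *)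

theory Defs
  imports Main
begin

definition subsets_of_card :: "nat \<Rightarrow> nat \<Rightarrow> nat set set" where
  "subsets_of_card n p = {\<sigma>. \<sigma> \<subseteq> {1..n} \<and> card \<sigma> = p}"

text \<open>
  The \<open>(\<sigma>, \<tau>)\<close> entry of \<open>M(n,p)\<close>. The formula does not depend on \<open>n\<close> and \<open>p\<close>, which only
  determine the index sets of rows and columns; \<open>the_elem\<close> is only meaningful for
  \<open>\<sigma> \<subseteq> \<tau>\<close> with \<open>card \<tau> = card \<sigma> + 1\<close>.
\<close>
definition M_entry :: "nat set \<Rightarrow> nat set \<Rightarrow> 'k::field" where
  "M_entry \<sigma> \<tau> =
     (if \<sigma> \<subseteq> \<tau> then (-1) ^ card {s \<in> \<tau>. s < the_elem (\<tau> - \<sigma>)} else 0)"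

text \<open>
  Linear dependence of the rows indexed by \<open>C\<close>, as a family: two equal rows with different
  indices count as dependent. Meant for finite \<open>C\<close>.
\<close>
definition rows_dependent ::
  "('r \<Rightarrow> 'c \<Rightarrow> 'k::field) \<Rightarrow> 'c set \<Rightarrow> 'r set \<Rightarrow> bool" where
  "rows_dependent A cols C \<longleftrightarrow>
     (\<exists>a. (\<exists>\<sigma>\<in>C. a \<sigma> \<noteq> 0) \<and> (\<forall>\<tau>\<in>cols. (\<Sum>\<sigma>\<in>C. a \<sigma> * A \<sigma> \<tau>) = 0))"

definition minimal_rows_dependent ::
  "('r \<Rightarrow> 'c \<Rightarrow> 'k::field) \<Rightarrow> 'c set \<Rightarrow> 'r set \<Rightarrow> bool" where
  "minimal_rows_dependent A cols C \<longleftrightarrow>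
     rows_dependent A cols C \<and> (\<forall>D. D \<subset> C \<longrightarrow> \<not> rows_dependent A cols D)"

text \<open>The type argument stands for the field \<open>k\<close> in \<open>C\<^sup>n\<^sub>p[k]\<close>.\<close>
definition row_circuits :: "'k::field itself \<Rightarrow> nat \<Rightarrow> nat \<Rightarrow> nat set set set" where
  "row_circuits _ n p =
     {C. C \<subseteq> subsets_of_card n p \<and>
         minimal_rows_dependent
           (M_entry :: nat set \<Rightarrow> nat set \<Rightarrow> 'k) (subsets_of_card n (p + 1)) C}"

definition complete_graph_edges :: "nat \<Rightarrow> nat set set" where
  "complete_graph_edges n = {e. e \<subseteq> {1..n} \<and> card e = 2}"

definition cycle_edges :: "'v list \<Rightarrow> 'v set set" where
  "cycle_edges vs = {{vs ! i, vs ! (Suc i mod length vs)} | i. i < length vs}"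

text \<open>Edge sets of the simple cycles of the graph with edge set \<open>E\<close>.\<close>
definition graph_circuits :: "'v set set \<Rightarrow> 'v set set set" where
  "graph_circuits E =
     {cycle_edges vs | vs. distinct vs \<and> 3 \<le> length vs \<and> cycle_edges vs \<subseteq> E}"

end

theory Submission
  imports Defs
begin

text \<open>
  Identify a row \<open>[n] - e\<close> with the edge \<open>e\<close> and a column \<open>[n] - {v}\<close> with the vertex \<open>v\<close>. After
  rescaling rows and columns by signs, \<open>M(n, n - 2)\<close> becomes the oriented incidence matrix of
  \<open>K\<^sub>n\<close>, so a linear relation among rows is a circulation: an antisymmetric function on ordered
  pairs of vertices with zero net flow at every vertex. A nonzero circulation never dies at a
  vertex, so following its support without backtracking closes up to a simple cycle. Conversely a
  simple cycle carries the unit circulation, and every circulation supported on it is constant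
  along it, hence vanishes as soon as one edge is missing.
\<close>

section \<open>Circulations on graphs\<close>

text \<open>In characteristic 2 antisymmetry alone leaves \<open>f v v\<close> free. The support
  condition makes it vanish as soon as all members of \<open>C\<close> have two elements.\<close>

definition circulation :: "'v set \<Rightarrow> 'v set set \<Rightarrow> ('v \<Rightarrow> 'v \<Rightarrow> 'k::field) \<Rightarrow> bool" where
  "circulation V C f \<longleftrightarrow>
     (\<forall>u v. f u v = - f v u) \<and> (\<forall>u v. f u v \<noteq> 0 \<longrightarrow> {u, v} \<in> C) \<and>
     (\<forall>v\<in>V. (\<Sum>u\<in>V. f v u) = 0)"

lemma circulationD:
  assumes "circulation V C f"
  shows "f u v = - f v u" "f u v \<noteq> 0 \<Longrightarrow> {u, v} \<in> C" "v \<in> V \<Longrightarrow> (\<Sum>u\<in>V. f v u) = 0"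
  using assms unfolding circulation_def by blast+

definition carries_circulation :: "'k::field itself \<Rightarrow> 'v set \<Rightarrow> 'v set set \<Rightarrow> bool" where
  "carries_circulation _ V C \<longleftrightarrow>
     (\<exists>f :: 'v \<Rightarrow> 'v \<Rightarrow> 'k. circulation V C f \<and> (\<exists>u v. f u v \<noteq> 0))"

text \<open>In a finite vertex set the walk must revisit a vertex. The segment ending at the first
  revisit has no other repetition, and \<open>step\<close> and \<open>nonback\<close> exclude the
  lengths 1 and 2.\<close>

lemma nonbacktracking_walk_contains_cycle:
  fixes x :: "nat \<Rightarrow> 'v"
  assumes "finite V" and "\<And>i. x i \<in> V"
    and step: "\<And>i. x (Suc i) \<noteq> x i" and nonback: "\<And>i. x (Suc (Suc i)) \<noteq> x i"
    and edge: "\<And>i. {x i, x (Suc i)} \<in> C"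
  obtains vs where "distinct vs" "3 \<le> length vs" "cycle_edges vs \<subseteq> C"
proof -
  have "\<exists>j. \<exists>i<j. x i = x j"
  proof (rule ccontr)
    assume "\<not> ?thesis"
    then have "inj x" by (metis injI linorder_neqE_nat)
    moreover have "finite (range x)"
      using assms(1,2) by (meson finite_subset image_subsetI)
    ultimately show False using finite_imageD infinite_UNIV_nat by blast
  qed
  \<comment> \<open>Leastness of \<open>j\<close> makes \<open>x\<close> injective on the indices
    below \<open>j\<close>, which gives distinctness of the segment.\<close>
  then obtain j where ex: "\<exists>i<j. x i = x j"
    and least: "\<And>j'. j' < j \<Longrightarrow> \<not> (\<exists>i<j'. x i = x j')"
    unfolding exists_least_iff[of "\<lambda>j. \<exists>i<j. x i = x j"] by blast
  from ex obtain i where i: "i < j" "x i = x j" by blast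
  define vs where "vs = map x [i..<j]"
  have len: "length vs = j - i" by (simp add: vs_def)
  have nth: "vs ! k = x (i + k)" if "k < j - i" for k using that by (simp add: vs_def)
  have "distinct vs"
    unfolding vs_def distinct_map
    by (auto intro!: inj_onI) (metis least linorder_neqE_nat)
  moreover have "3 \<le> length vs"
  proof -
    have "j \<noteq> Suc i" "j \<noteq> Suc (Suc i)" using i step nonback by metis+
    then show ?thesis using i len by linarith
  qed
  moreover have "cycle_edges vs \<subseteq> C"
  proof
    fix e assume "e \<in> cycle_edges vs"
    then obtain k where k: "k < j - i" "e = {vs ! k, vs ! (Suc k mod length vs)}"
      by (auto simp: cycle_edges_def len)
    \<comment> \<open>At the last index the modulus wraps to 0, and \<open>x i = x j\<close> makes
      the closing edge a step of the walk.\<close>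
    have "vs ! (Suc k mod length vs) = x (Suc (i + k))"
    proof (cases "Suc k = j - i")
      case True
      then have "Suc (i + k) = j" using i by simp
      then show ?thesis using True i nth[of 0] by (simp add: len)
    next
      case False
      then show ?thesis using k nth[of "Suc k"] by (simp add: len)
    qed
    then show "e \<in> C" using k nth edge by simp
  qed
  ultimately show ?thesis by (rule that)
qed

lemma carries_circulation_contains_cycle:
  fixes V :: "'v set"
  assumes "finite V" and C: "\<And>e. e \<in> C \<Longrightarrow> e \<subseteq> V \<and> card e = 2"
    and "carries_circulation TYPE('k::field) V C"
  obtains vs where "distinct vs" "3 \<le> length vs" "cycle_edges vs \<subseteq> C"
proof -
  obtain f :: "'v \<Rightarrow> 'v \<Rightarrow> 'k" and u0 v0 where f: "circulation V C f" and uv0: "f u0 v0 \<noteq> 0"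
    using assms(3) by (auto simp: carries_circulation_def)
  have anti: "f u v = - f v u" for u v using f by (rule circulationD)
  have supp: "{u, v} \<in> C" if "f u v \<noteq> 0" for u v using f that by (rule circulationD)
  have inV: "u \<in> V" "v \<in> V" "u \<noteq> v" if "f u v \<noteq> 0" for u v
    using C[OF supp[OF that]] by auto
  \<comment> \<open>If \<open>u\<close> were the only vertex with flow out of \<open>v\<close>, the
    net flow at \<open>v\<close> would be the single term \<open>f v u = - f u v\<close>, which is
    nonzero.\<close>
  have continue: "\<exists>w. w \<noteq> u \<and> f v w \<noteq> 0" if "f u v \<noteq> 0" for u v
  proof (rule ccontr)
    assume "\<not> ?thesis"
    then have "(\<Sum>w\<in>V. f v w) = (\<Sum>w\<in>{u}. f v w)"
      using \<open>finite V\<close> inV[OF that] by (intro sum.mono_neutral_right) auto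
    moreover have "(\<Sum>w\<in>V. f v w) = 0"
      using f inV(2)[OF that] by (rule circulationD)
    ultimately show False using that anti[of u v] by simp
  qed
  \<comment> \<open>The choice runs over arcs rather than vertices, since avoiding backtracking
    requires remembering the previous vertex.\<close>
  have "\<exists>p :: nat \<Rightarrow> 'v \<times> 'v. \<forall>i. f (fst (p i)) (snd (p i)) \<noteq> 0 \<and>
    (fst (p (Suc i)) = snd (p i) \<and> snd (p (Suc i)) \<noteq> fst (p i))"
  proof (rule dependent_nat_choice)
    show "\<exists>q. f (fst q) (snd q) \<noteq> 0" using uv0 by force
    fix q :: "'v \<times> 'v" and i :: nat assume "f (fst q) (snd q) \<noteq> 0"
    then obtain w where "w \<noteq> fst q" "f (snd q) w \<noteq> 0" using continue by blast
    then show "\<exists>r. f (fst r) (snd r) \<noteq> 0 \<and> fst r = snd q \<and> snd r \<noteq> fst q"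
      by (intro exI[of _ "(snd q, w)"]) simp
  qed
  then obtain p :: "nat \<Rightarrow> 'v \<times> 'v"
    where p: "\<And>i. f (fst (p i)) (snd (p i)) \<noteq> 0" "\<And>i. snd (p i) = fst (p (Suc i))"
      "\<And>i. snd (p (Suc i)) \<noteq> fst (p i)"
    by metis
  define x where "x i = fst (p i)" for i
  have nz: "f (x i) (x (Suc i)) \<noteq> 0" and nonback: "x (Suc (Suc i)) \<noteq> x i" for i
    using p(1)[of i] p(3)[of i] by (simp_all add: x_def p(2))
  show ?thesis
  proof (rule nonbacktracking_walk_contains_cycle[of V x C])
    show "x i \<in> V" "x (Suc i) \<noteq> x i" "{x i, x (Suc i)} \<in> C" for i
      using inV(1,3)[OF nz[of i]] supp[OF nz[of i]] by auto
  qed (use \<open>finite V\<close> nonback that in auto)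
qed

text \<open>Simple cycles as periodic walks, which keeps index arithmetic modulo the length implicit.\<close>

definition cyclic_walk :: "'v list \<Rightarrow> nat \<Rightarrow> 'v" where
  "cyclic_walk vs k = vs ! (k mod length vs)"

lemma cyclic_walk_eq_iff:
  assumes "distinct vs" "vs \<noteq> []"
  shows "cyclic_walk vs i = cyclic_walk vs j \<longleftrightarrow> i mod length vs = j mod length vs"
  using assms by (simp add: cyclic_walk_def nth_eq_iff_index_eq)

text \<open>Both directions matter: every vertex of the cycle has a unique successor and a unique
  predecessor, whatever index represents it.\<close>

lemma cyclic_walk_Suc_eq_iff:
  assumes "distinct vs" "vs \<noteq> []"
  shows "cyclic_walk vs (Suc i) = cyclic_walk vs (Suc j) \<longleftrightarrow> cyclic_walk vs i = cyclic_walk vs j"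
proof -
  have "Suc i mod length vs = Suc j mod length vs \<longleftrightarrow> i mod length vs = j mod length vs"
    by (auto simp: mod_Suc split: if_splits)
  then show ?thesis using assms by (auto simp: cyclic_walk_eq_iff)
qed

text \<open>This is where length at least 3 enters: the two neighbours of a vertex on the cycle are
  different.\<close>

lemma cyclic_walk_Suc_Suc_neq:
  assumes "distinct vs" "3 \<le> length vs"
  shows "cyclic_walk vs (Suc (Suc i)) \<noteq> cyclic_walk vs i"
proof -
  have "vs \<noteq> []" using assms by auto
  then show ?thesis using assms by (auto simp: cyclic_walk_eq_iff mod_Suc)
qed

lemma cycle_edges_eq_cyclic_walk:
  assumes "vs \<noteq> []"
  shows "cycle_edges vs = range (\<lambda>k. {cyclic_walk vs k, cyclic_walk vs (Suc k)})"
proof -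
  have "\<exists>i. {vs ! (k mod length vs), vs ! (Suc k mod length vs)} =
      {vs ! i, vs ! (Suc i mod length vs)} \<and> i < length vs" for k
    using assms by (intro exI[of _ "k mod length vs"]) (simp add: mod_Suc_eq)
  moreover have "\<exists>k. {vs ! i, vs ! (Suc i mod length vs)} =
      {vs ! (k mod length vs), vs ! (Suc k mod length vs)}" if "i < length vs" for i
    using that by (intro exI[of _ i]) simp
  ultimately show ?thesis
    unfolding cycle_edges_def cyclic_walk_def by blast
qed

section \<open>Circulations on a simple cycle and minimal supports\<close>

lemma sum_of_bool_unique:
  assumes "finite V" "w \<in> V" "\<And>u. P u \<longleftrightarrow> u = w"
  shows "(\<Sum>u\<in>V. of_bool (P u)) = (1 :: 'k::field)"
  using assms by (simp add: of_bool_def)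

text \<open>The unit flow around the cycle is conserved because each vertex on it has exactly one
  outgoing and one incoming arc.\<close>

lemma cycle_edges_carries_circulation:
  fixes V :: "'v set"
  assumes "finite V" "distinct vs" "3 \<le> length vs" and sub: "\<And>e. e \<in> cycle_edges vs \<Longrightarrow> e \<subseteq> V"
  shows "carries_circulation TYPE('k::field) V (cycle_edges vs)"
proof -
  let ?x = "cyclic_walk vs"
  have ne: "vs \<noteq> []" using assms by auto
  have edges: "cycle_edges vs = range (\<lambda>k. {?x k, ?x (Suc k)})"
    using ne by (rule cycle_edges_eq_cyclic_walk)
  have inV: "?x k \<in> V" for k using sub[of "{?x k, ?x (Suc k)}"] edges by auto
  have suc: "?x (Suc i) = ?x (Suc j) \<longleftrightarrow> ?x i = ?x j" for i j
    using assms ne by (intro cyclic_walk_Suc_eq_iff)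
  have two: "?x (Suc (Suc i)) \<noteq> ?x i" for i
    using assms by (intro cyclic_walk_Suc_Suc_neq)
  define arc where "arc u v \<longleftrightarrow> (\<exists>k. u = ?x k \<and> v = ?x (Suc k))" for u v
  define f :: "'v \<Rightarrow> 'v \<Rightarrow> 'k" where "f u v = of_bool (arc u v) - of_bool (arc v u)" for u v
  have "(\<Sum>u\<in>V. f v u) = 0" for v
  proof (cases "v \<in> range ?x")
    case True
    then obtain k where k: "v = ?x k" by blast
    have period: "?x (k + length vs) = ?x k" by (simp add: cyclic_walk_def)
    \<comment> \<open>Index 0 has no predecessor in the naturals, so the predecessor is taken one
      period later, at \<open>k + length vs - 1\<close>.\<close>
    obtain m where m: "v = ?x (Suc m)"
      using k period ne by (metis add_Suc_right gr0_implies_Suc length_greater_0_conv)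
    have "arc v u \<longleftrightarrow> u = ?x (Suc k)" for u unfolding arc_def k using suc by metis
    then have "(\<Sum>u\<in>V. of_bool (arc v u)) = (1::'k)"
      by (intro sum_of_bool_unique[OF \<open>finite V\<close> inV])
    moreover have "arc u v \<longleftrightarrow> u = ?x m" for u unfolding arc_def m using suc by metis
    then have "(\<Sum>u\<in>V. of_bool (arc u v)) = (1::'k)"
      by (intro sum_of_bool_unique[OF \<open>finite V\<close> inV])
    ultimately show ?thesis by (simp add: f_def sum_subtractf)
  next
    case False
    then have "f v u = 0" for u by (auto simp: f_def arc_def)
    then show ?thesis by simp
  qed
  then have "circulation V (cycle_edges vs) f"
    unfolding circulation_def by (auto simp: f_def edges arc_def insert_commute)
  moreover have "arc (?x 0) (?x (Suc 0))" by (auto simp: arc_def)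
  \<comment> \<open>Without this the two indicators in \<open>f\<close> would cancel on the edge; it
    holds since the walk does not return after two steps.\<close>
  moreover have "\<not> arc (?x (Suc 0)) (?x 0)" unfolding arc_def using suc two by metis
  ultimately show ?thesis
    unfolding carries_circulation_def
    by (intro exI[of _ f] conjI exI[of _ "?x 0"] exI[of _ "?x (Suc 0)"]) (auto simp: f_def)
qed

text \<open>Conservation at each vertex passes the value of one cycle edge on to the next, so the
  flow is constant along the cycle. A missing edge makes that constant 0.\<close>

lemma proper_subset_cycle_no_circulation:
  fixes V :: "'v set"
  assumes "finite V" "distinct vs" "3 \<le> length vs"
    and sub: "\<And>e. e \<in> cycle_edges vs \<Longrightarrow> e \<subseteq> V" and D: "D \<subset> cycle_edges vs"
  shows "\<not> carries_circulation TYPE('k::field) V D"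
proof
  assume "carries_circulation TYPE('k) V D"
  then obtain f :: "'v \<Rightarrow> 'v \<Rightarrow> 'k" and a b where f: "circulation V D f" and ab: "f a b \<noteq> 0"
    by (auto simp: carries_circulation_def)
  let ?x = "cyclic_walk vs"
  have ne: "vs \<noteq> []" using assms by auto
  have edges: "cycle_edges vs = range (\<lambda>k. {?x k, ?x (Suc k)})"
    using ne by (rule cycle_edges_eq_cyclic_walk)
  have inV: "?x k \<in> V" for k using sub[of "{?x k, ?x (Suc k)}"] edges by auto
  have suc: "?x (Suc i) = ?x (Suc j) \<longleftrightarrow> ?x i = ?x j" for i j
    using assms ne by (intro cyclic_walk_Suc_eq_iff)
  have two: "?x (Suc (Suc i)) \<noteq> ?x i" for i
    using assms by (intro cyclic_walk_Suc_Suc_neq)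
  have anti: "f u v = - f v u" for u v using f by (rule circulationD)
  have supp: "{u, v} \<in> D" if "f u v \<noteq> 0" for u v using f that by (rule circulationD)
  have step: "f (?x (Suc k)) (?x (Suc (Suc k))) = f (?x k) (?x (Suc k))" for k
  proof -
    \<comment> \<open>Flow at a vertex of the cycle can only use its two cycle neighbours, so the
      vertex sum has at most two nonzero terms.\<close>
    have "u = ?x k \<or> u = ?x (Suc (Suc k))" if nz: "f (?x (Suc k)) u \<noteq> 0" for u
    proof -
      obtain m where "{?x (Suc k), u} = {?x m, ?x (Suc m)}"
        using supp[OF nz] D edges by blast
      then show ?thesis using suc by (metis doubleton_eq_iff)
    qed
    then have "(\<Sum>u\<in>V. f (?x (Suc k)) u) = (\<Sum>u\<in>{?x k, ?x (Suc (Suc k))}. f (?x (Suc k)) u)"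
      using \<open>finite V\<close> inV by (intro sum.mono_neutral_right) auto
    moreover have "(\<Sum>u\<in>V. f (?x (Suc k)) u) = 0" using f inV by (rule circulationD)
    ultimately have "f (?x (Suc k)) (?x k) + f (?x (Suc k)) (?x (Suc (Suc k))) = 0"
      using two[of k] by (simp add: two[symmetric])
    then show ?thesis using anti[of "?x k" "?x (Suc k)"] by (simp add: add_eq_0_iff)
  qed
  have const: "f (?x k) (?x (Suc k)) = f (?x 0) (?x (Suc 0))" for k
    by (induction k) (simp_all add: step)
  obtain m where m: "{?x m, ?x (Suc m)} \<notin> D" using D edges by auto
  then have zero: "f (?x k) (?x (Suc k)) = 0" for k
    using supp const[of k] const[of m] by metis
  obtain k where "{a, b} = {?x k, ?x (Suc k)}" using supp[OF ab] D edges by blast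
  then show False using zero[of k] ab anti[of a b] by (auto simp: doubleton_eq_iff)
qed

text \<open>A carrying set contains a cycle, and that cycle already carries a circulation, so
  minimality forces equality. The converse combines the two preceding lemmas.\<close>

lemma minimal_circulation_iff_graph_circuit:
  fixes V :: "'v set"
  assumes "finite V" and C: "C \<subseteq> {e. e \<subseteq> V \<and> card e = 2}"
  shows "carries_circulation TYPE('k::field) V C \<and>
      (\<forall>D. D \<subset> C \<longrightarrow> \<not> carries_circulation TYPE('k) V D) \<longleftrightarrow>
    C \<in> graph_circuits {e. e \<subseteq> V \<and> card e = 2}" (is "?L \<longleftrightarrow> ?R")
proof
  assume ?L
  have edge: "e \<subseteq> V \<and> card e = 2" if "e \<in> C" for e using that C by auto
  obtain vs where vs: "distinct vs" "3 \<le> length vs" "cycle_edges vs \<subseteq> C"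
    using carries_circulation_contains_cycle[of V C, where ?'k = 'k] \<open>?L\<close> edge \<open>finite V\<close> by metis
  have "carries_circulation TYPE('k) V (cycle_edges vs)"
    using vs edge \<open>finite V\<close> by (intro cycle_edges_carries_circulation) auto
  then have "C = cycle_edges vs" using \<open>?L\<close> vs(3) by blast
  then show ?R using vs C by (auto simp: graph_circuits_def)
next
  assume ?R
  then obtain vs where vs: "distinct vs" "3 \<le> length vs" "C = cycle_edges vs"
    by (auto simp: graph_circuits_def)
  have "e \<subseteq> V" if "e \<in> cycle_edges vs" for e using that C vs(3) by auto
  then show ?L
    using cycle_edges_carries_circulation[of V vs, where ?'k = 'k]
      proper_subset_cycle_no_circulation[of V vs, where ?'k = 'k] vs \<open>finite V\<close> by blast
qed

section \<open>The matrix as an oriented incidence matrix\<close>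

text \<open>The exponent counts the elements below \<open>v\<close> other than \<open>u\<close>:
  there are \<open>v - 2\<close> if \<open>u < v\<close> and \<open>v - 1\<close> otherwise. After
  multiplication by \<open>(-1) ^ u\<close> the entries at the two ends of an edge are
  opposite.\<close>

lemma M_entry_complement_edge:
  assumes "u \<in> {1..n}" "v \<in> {1..n}" "u \<noteq> v"
  shows "(M_entry ({1..n} - {u, v}) ({1..n} - {u}) :: 'k::field) =
    (if u < v then (-1) ^ v else - ((-1) ^ v))"
proof -
  have "({1..n} - {u}) - ({1..n} - {u, v}) = {v}" using assms by auto
  then have M: "(M_entry ({1..n} - {u, v}) ({1..n} - {u}) :: 'k) =
      (-1) ^ card {s \<in> {1..n} - {u}. s < v}"
    by (auto simp: M_entry_def)
  have set: "{s \<in> {1..n} - {u}. s < v} = {1..<v} - {u}" using assms by auto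
  show ?thesis
  proof (cases "u < v")
    case True
    then have "card ({1..<v} - {u}) + 2 = v" using assms by (simp add: card_Diff_singleton)
    then have "(-1 :: 'k) ^ v = (-1) ^ (card ({1..<v} - {u}) + 2)" by simp
    then show ?thesis using True M set by simp
  next
    case False
    then have "card ({1..<v} - {u}) + 1 = v" using assms by simp
    then have "(-1 :: 'k) ^ v = (-1) ^ (card ({1..<v} - {u}) + 1)" by simp
    then show ?thesis using False M set by simp
  qed
qed

lemma inj_on_complement: "inj_on (\<lambda>e. V - e) {e. e \<subseteq> V}"
  by (rule inj_onI) blast

text \<open>Applied with \<open>p = 2\<close> to index rows by edges and with \<open>p = 1\<close>
  to index columns by vertices.\<close>

lemma subsets_of_card_complement:
  assumes "p \<le> n"
  shows "subsets_of_card n (n - p) = (\<lambda>e. {1..n} - e) ` subsets_of_card n p"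
proof -
  have "\<sigma> \<in> (\<lambda>e. {1..n} - e) ` subsets_of_card n p" if "\<sigma> \<subseteq> {1..n}" "card \<sigma> = n - p" for \<sigma>
  proof
    show "\<sigma> = {1..n} - ({1..n} - \<sigma>)" using that by auto
    show "{1..n} - \<sigma> \<in> subsets_of_card n p"
      using that assms by (auto simp: subsets_of_card_def card_Diff_subset finite_subset)
  qed
  then show ?thesis
    by (auto simp: subsets_of_card_def card_Diff_subset finite_subset)
qed

section \<open>Row relations as circulations\<close>

text \<open>For fixed \<open>v\<close>, the map sending \<open>u\<close> to \<open>{v, u}\<close> is
  a bijection from the neighbours of \<open>v\<close> to the edges through \<open>v\<close>.\<close>

lemma vertex_sum_eq_edge_sum:
  fixes g :: "'v set \<Rightarrow> 'k::field"
  assumes "finite V" and C: "\<And>e. e \<in> C \<Longrightarrow> e \<subseteq> V \<and> card e = 2"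
  shows "(\<Sum>u\<in>V. if {v, u} \<in> C then g {v, u} else 0) = (\<Sum>e\<in>C. if v \<in> e then g e else 0)"
proof -
  have finC: "finite C" using assms by (meson Pow_iff finite_Pow_iff finite_subset subsetI)
  have "(\<Sum>u\<in>V. if {v, u} \<in> C then g {v, u} else 0) = (\<Sum>u\<in>{u\<in>V. {v, u} \<in> C}. g {v, u})"
    using \<open>finite V\<close> by (simp add: sum.inter_filter)
  also have "\<dots> = (\<Sum>e\<in>{e\<in>C. v \<in> e}. g e)"
  proof (rule sum.reindex_bij_betw, rule bij_betw_imageI)
    show "inj_on (\<lambda>u. {v, u}) {u \<in> V. {v, u} \<in> C}"
      by (auto intro!: inj_onI simp: doubleton_eq_iff)
    have "e \<in> (\<lambda>u. {v, u}) ` {u \<in> V. {v, u} \<in> C}" if e: "e \<in> C" "v \<in> e" for e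
    proof -
      obtain u where "e = {v, u}" using C[OF e(1)] e(2) by (auto simp: card_2_iff)
      then show ?thesis using C[OF e(1)] e by auto
    qed
    then show "(\<lambda>u. {v, u}) ` {u \<in> V. {v, u} \<in> C} = {e \<in> C. v \<in> e}" by auto
  qed
  also have "\<dots> = (\<Sum>e\<in>C. if v \<in> e then g e else 0)"
    using finC by (simp add: sum.inter_filter)
  finally show ?thesis .
qed

text \<open>Column \<open>{1..n} - {v}\<close> contains row \<open>{1..n} - e\<close> only if
  \<open>v\<close> lies in \<open>e\<close>, so the row sum runs over the edges at \<open>v\<close>
  and thus over its neighbours.\<close>

lemma row_sum_complement:
  fixes a :: "nat set \<Rightarrow> 'k::field"
  assumes C: "C \<subseteq> subsets_of_card n 2" and v: "v \<in> {1..n}"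
  shows "(\<Sum>\<sigma>\<in>(\<lambda>e. {1..n} - e) ` C. a \<sigma> * M_entry \<sigma> ({1..n} - {v})) =
    (\<Sum>u\<in>{1..n}. if {v, u} \<in> C
       then a ({1..n} - {v, u}) * M_entry ({1..n} - {v, u}) ({1..n} - {v}) else 0)"
proof -
  have inj: "inj_on (\<lambda>e. {1..n} - e) C"
    using C by (intro inj_on_subset[OF inj_on_complement]) (auto simp: subsets_of_card_def)
  have zero: "(M_entry ({1..n} - e) ({1..n} - {v}) :: 'k) = 0" if "v \<notin> e" for e
    using that v by (auto simp: M_entry_def)
  have "(\<Sum>\<sigma>\<in>(\<lambda>e. {1..n} - e) ` C. a \<sigma> * M_entry \<sigma> ({1..n} - {v})) =
      (\<Sum>e\<in>C. if v \<in> e then a ({1..n} - e) * M_entry ({1..n} - e) ({1..n} - {v}) else 0)"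
    unfolding sum.reindex[OF inj] comp_def by (rule sum.cong) (simp_all add: zero del: One_nat_def)
  also have "\<dots> = (\<Sum>u\<in>{1..n}. if {v, u} \<in> C
       then a ({1..n} - {v, u}) * M_entry ({1..n} - {v, u}) ({1..n} - {v}) else 0)"
    using C by (intro vertex_sum_eq_edge_sum[symmetric]) (auto simp: subsets_of_card_def)
  finally show ?thesis .
qed

lemma rows_dependent_iff_carries_circulation:
  assumes "n \<ge> 3" and C: "C \<subseteq> subsets_of_card n 2"
  shows "rows_dependent (M_entry :: nat set \<Rightarrow> nat set \<Rightarrow> 'k::field) (subsets_of_card n (n - 1))
      ((\<lambda>e. {1..n} - e) ` C) \<longleftrightarrow> carries_circulation TYPE('k) {1..n} C"
proof -
  let ?M = "M_entry :: nat set \<Rightarrow> nat set \<Rightarrow> 'k"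
  let ?c = "\<lambda>e. {1..n} - e"
  have edge: "u \<in> {1..n}" "v \<in> {1..n}" "u \<noteq> v" if "{u, v} \<in> C" for u v
    using C that by (auto simp: subsets_of_card_def card_insert_if split: if_splits)
  have cols: "subsets_of_card n (n - 1) = (\<lambda>v. ?c {v}) ` {1..n}"
    using assms by (subst subsets_of_card_complement)
      (auto simp: subsets_of_card_def card_1_singleton_iff image_iff)
  have sign2: "(-1 :: 'k) ^ k * (-1) ^ k = 1" for k
    by (simp flip: power_add mult_2)
  have dep: "rows_dependent ?M (subsets_of_card n (n - 1)) (?c ` C) \<longleftrightarrow>
      (\<exists>a. (\<exists>e\<in>C. a (?c e) \<noteq> 0) \<and> (\<forall>v\<in>{1..n}. (\<Sum>u\<in>{1..n}. if {v, u} \<in> C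
        then a (?c {v, u}) * ?M (?c {v, u}) (?c {v}) else 0) = 0))"
    unfolding rows_dependent_def cols
    by (simp add: row_sum_complement[OF C] del: atLeastAtMost_iff One_nat_def)
  show ?thesis
  proof
    assume "rows_dependent ?M (subsets_of_card n (n - 1)) (?c ` C)"
    then obtain a e where e: "e \<in> C" "a (?c e) \<noteq> 0"
      and a: "\<And>v. v \<in> {1..n} \<Longrightarrow> (\<Sum>u\<in>{1..n}. if {v, u} \<in> C
        then a (?c {v, u}) * ?M (?c {v, u}) (?c {v}) else 0) = 0"
      unfolding dep by blast
    \<comment> \<open>The factor \<open>(-1) ^ u\<close> rescales the column of \<open>u\<close>,
      which turns the two entries of each row into opposite ones; hence antisymmetry.\<close>
    define f where "f u v = (if {u, v} \<in> C
      then (-1) ^ u * (a (?c {u, v}) * ?M (?c {u, v}) (?c {u})) else 0)" for u v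
    have "f u v = - f v u" for u v
    proof (cases "{u, v} \<in> C")
      case True
      then show ?thesis
        using edge[OF True] M_entry_complement_edge[of u n v, where ?'k = 'k]
          M_entry_complement_edge[of v n u, where ?'k = 'k]
        by (auto simp: f_def insert_commute)
    qed (simp add: f_def insert_commute)
    moreover have "(\<Sum>u\<in>{1..n}. f v u) = 0" if "v \<in> {1..n}" for v
    proof -
      have "(\<Sum>u\<in>{1..n}. f v u) = (-1) ^ v * (\<Sum>u\<in>{1..n}. if {v, u} \<in> C
        then a (?c {v, u}) * ?M (?c {v, u}) (?c {v}) else 0)"
        unfolding sum_distrib_left by (rule sum.cong) (auto simp: f_def)
      then show ?thesis using a[OF that] by simp
    qed
    moreover have "{u, v} \<in> C" if "f u v \<noteq> 0" for u v
      using that by (auto simp: f_def split: if_splits)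
    ultimately have "circulation {1..n} C f"
      unfolding circulation_def by blast
    moreover obtain u v where uv: "e = {u, v}"
      using e C by (auto simp: subsets_of_card_def card_2_iff)
    then have "f u v \<noteq> 0"
      using e edge[of u v] M_entry_complement_edge[of u n v, where ?'k = 'k] by (simp add: f_def)
    ultimately show "carries_circulation TYPE('k) {1..n} C"
      unfolding carries_circulation_def by blast
  next
    assume "carries_circulation TYPE('k) {1..n} C"
    then obtain f :: "nat \<Rightarrow> nat \<Rightarrow> 'k" and x y where f: "circulation {1..n} C f"
      and xy: "f x y \<noteq> 0"
      by (auto simp: carries_circulation_def)
    have anti: "f u v = - f v u" for u v using f by (rule circulationD)
    have supp: "{u, v} \<in> C" if "f u v \<noteq> 0" for u v using f that by (rule circulationD)
    \<comment> \<open>A coefficient depends on an unordered edge, so the edge is oriented from its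
      smaller to its larger end. The sign \<open>(-1) ^ u * (-1) ^ v\<close> undoes the row and
      column rescaling.\<close>
    define a where "a \<sigma> = (let e = ?c \<sigma> in (-1) ^ Min e * (-1) ^ Max e * f (Min e) (Max e))" for \<sigma>
    have a_eq: "a (?c {u, v}) = (-1) ^ u * (-1) ^ v * (if u < v then f u v else f v u)"
      if "{u, v} \<in> C" for u v
    proof -
      have "?c (?c {u, v}) = {u, v}" using edge[OF that] by auto
      then show ?thesis using edge[OF that] by (auto simp: a_def Let_def min_def max_def)
    qed
    have "(if {v, u} \<in> C then a (?c {v, u}) * ?M (?c {v, u}) (?c {v}) else 0) = (-1) ^ v * f v u"
      for u v
    proof (cases "{v, u} \<in> C")
      case True
      \<comment> \<open>The sign \<open>(-1) ^ u\<close> of the matrix entry cancels against the one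
        in \<open>a\<close>, and the common factor \<open>(-1) ^ v\<close> leaves the sum over
        \<open>u\<close>.\<close>
      have "(-1) ^ v * (-1) ^ u * z * (-1) ^ u = (-1) ^ v * (z :: 'k)" for z
        using sign2[of u] by (simp add: mult.assoc mult.left_commute[of _ z])
      then show ?thesis
        unfolding a_eq[OF True] M_entry_complement_edge[OF edge[OF True]]
        using True anti[of u v] by simp
    next
      case False
      then show ?thesis using supp by auto
    qed
    then have "(\<Sum>u\<in>{1..n}. if {v, u} \<in> C
        then a (?c {v, u}) * ?M (?c {v, u}) (?c {v}) else 0) = 0" if "v \<in> {1..n}" for v
      using circulationD(3)[OF f that] by (simp flip: sum_distrib_left)
    moreover have "a (?c {x, y}) \<noteq> 0"
      using a_eq[OF supp[OF xy]] xy anti[of x y] by auto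
    ultimately show "rows_dependent ?M (subsets_of_card n (n - 1)) (?c ` C)"
      unfolding dep using supp[OF xy] by blast
  qed
qed

section \<open>Transfer of minimality along complementation\<close>

theorem proposition3p7:
  fixes n :: nat
  assumes "n \<ge> 3"
  shows "row_circuits TYPE('k::field) n (n - 2) =
    {(\<lambda>e. {1..n} - e) ` C | C. C \<in> graph_circuits (complete_graph_edges n)}"
proof -
  let ?c = "\<lambda>e. {1..n} - e"
  let ?E = "subsets_of_card n 2"
  let ?min = "minimal_rows_dependent (M_entry :: nat set \<Rightarrow> nat set \<Rightarrow> 'k)
    (subsets_of_card n (n - 1))"
  have p: "n - 2 + 1 = n - 1" using assms by simp
  have E: "complete_graph_edges n = ?E" "{e. e \<subseteq> {1..n} \<and> card e = 2} = ?E"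
    by (simp_all add: complete_graph_edges_def subsets_of_card_def)
  have min_iff: "?min (?c ` C) \<longleftrightarrow> C \<in> graph_circuits ?E" if C: "C \<subseteq> ?E" for C
  proof -
    have "inj_on ?c C"
      using C by (intro inj_on_subset[OF inj_on_complement]) (auto simp: subsets_of_card_def)
    then have "?c ` D \<subset> ?c ` C" if "D \<subset> C" for D
      using that inj_on_image_eq_iff[of ?c C D C] by blast
    moreover have "\<exists>D'. D' \<subset> C \<and> D = ?c ` D'" if "D \<subset> ?c ` C" for D
    proof -
      obtain D' where "D' \<subseteq> C" "D = ?c ` D'"
        using \<open>D \<subset> ?c ` C\<close> by (blast elim: subset_imageE)
      then show ?thesis using that by (intro exI[of _ D']) auto
    qed
    \<comment> \<open>Complementation is injective on \<open>C\<close>, so proper subsets of the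
      image are exactly the images of proper subsets. Minimality therefore transfers for any
      predicate \<open>P\<close>.\<close>
    ultimately have psub: "(\<forall>D. D \<subset> ?c ` C \<longrightarrow> \<not> P D) \<longleftrightarrow> (\<forall>D. D \<subset> C \<longrightarrow> \<not> P (?c ` D))" for P
      by metis
    have dep: "rows_dependent (M_entry :: nat set \<Rightarrow> nat set \<Rightarrow> 'k)
        (subsets_of_card n (n - 1)) (?c ` D) \<longleftrightarrow> carries_circulation TYPE('k) {1..n} D" if "D \<subseteq> C" for D
      using that C by (intro rows_dependent_iff_carries_circulation[OF assms]) blast
    have "?min (?c ` C) \<longleftrightarrow> carries_circulation TYPE('k) {1..n} C \<and>
        (\<forall>D. D \<subset> C \<longrightarrow> \<not> carries_circulation TYPE('k) {1..n} D)"
      unfolding minimal_rows_dependent_def psub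
      by (auto simp: dep psubset_imp_subset simp del: One_nat_def)
    then show ?thesis
      using minimal_circulation_iff_graph_circuit[of "{1..n}" C, where ?'k = 'k] C
      unfolding E by simp
  qed
  have sub: "C \<subseteq> ?E" if "C \<in> graph_circuits ?E" for C
    using that by (auto simp: graph_circuits_def)
  have rows: "subsets_of_card n (n - 2) = ?c ` ?E"
    using assms by (intro subsets_of_card_complement) simp
  show ?thesis
  proof (rule set_eqI, unfold row_circuits_def p rows E mem_Collect_eq)
    fix S
    have "S \<subseteq> ?c ` ?E \<and> ?min S \<longleftrightarrow> (\<exists>C. C \<subseteq> ?E \<and> S = ?c ` C \<and> ?min (?c ` C))"
      unfolding subset_image_iff by auto
    also have "\<dots> \<longleftrightarrow> (\<exists>C. S = ?c ` C \<and> C \<in> graph_circuits ?E)"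
      using min_iff sub by metis
    finally show "S \<subseteq> ?c ` ?E \<and> ?min S \<longleftrightarrow> (\<exists>C. S = ?c ` C \<and> C \<in> graph_circuits ?E)" .
  qed
qed

end
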